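(* Let $ABC$ be a nondegenerate triangle in $\mathbb{R}^2$, let $X_{\mathrm{Mal}}\in\mathbb{R}^9$ be its Malfatti configuration, and let $T_{0.9}$ be the simultaneous LC–CC update map with contraction parameter $q=0.9$ (as defined in the context). Then there exists a sufficiently small neighborhood $U$ of $X_{\mathrm{Mal}}$ in $\mathbb{R}^9$ such that, for every initial configuration $X_0\in U$, the sequence defined recursively by $X_{n+1}=T_{0.9}(X_n)$ (is well defined for all $n\ge 0$ and) converges geometrically to $X_{\mathrm{Mal}}$. Hence $X_{\mathrm{Mal}}$ is a locally asymptotically stable fixed point of $T_{0.9}$.
   Context: States. A state is a vector $X=(P_1,r_1,P_2,r_2,P_3,r_3)\in\mathbb{R}^9$ with $P_i\in\mathbb{R}^2$ (center of the circle $C_i$) and $r_i\in\mathbb{R}$ (its radius). $\mathbb{R}^9$ carries the Euclidean norm. Malfatti configuration. For a nondegenerate triangle $ABC$, the Malfatti circles are the three circles $C_1,C_2,C_3$ contained in the closed triangle, such that $C_1$ is tangent to the sides $AB$ and $AC$, $C_2$ is tangent to $AB$ and $BC$, $C_3$ is tangent to $BC$ and $CA$, and $C_1,C_2,C_3$ are pairwise externally tangent. (Such a triple exists and is unique, a classical fact.) $X_{\mathrm{Mal}}$ is the corresponding state, with the (positive) radii and the centers of these circles. LC module with parameter $q$, for a circle with center $P$ and radius $r$ and a fixed line $L$ with $P\notin L$: let $h=\operatorname{dist}(P,L)$, $d=r-h$ (contact error), and let $\mathbf{n}$ be the unit vector perpendicular to $L$ pointing from $L$ toward $P$. The module produces the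 correction $\Delta P=\frac{(1-q)d}{2}\mathbf{n}$, $\Delta r=-\frac{(1-q)d}{2}$. CC module with parameter $q$, for two circles with centers $P_i\ne P_j$ and radii $r_i,r_j$: let $d=\|P_j-P_i\|-r_i-r_j$ (contact error) and $\mathbf{u}=\frac{P_j-P_i}{\|P_j-P_i\|}$. The module produces the corrections $\Delta P_i=\frac{1-q}{4}d\,\mathbf{u}$, $\Delta P_j=-\frac{1-q}{4}d\,\mathbf{u}$, $\Delta r_i=\Delta r_j=\frac{1-q}{4}d$. Update map. $T_q(X)$ is obtained from $X$ by adding to $X$ the sum of the corrections, all evaluated at the same current state $X$, of the following nine modules: the six LC modules for the pairs (circle, line) $(C_1,AB)$, $(C_1,AC)$, $(C_2,AB)$, $(C_2,BC)$, $(C_3,BC)$, $(C_3,CA)$, where the lines are the lines through the sides of the triangle, and the three CC modules for the pairs $(C_1,C_2)$, $(C_2,C_3)$, $(C_1,C_3)$. $T_q$ is defined on the open set of states in which no center lies on a line used in its LC modules and the three centers are pairwise distinct; this set contains $X_{\mathrm{Mal}}$. Terminology. A sequence $(X_n)$ converges geometrically to $X^*$ if there are constants $K\ge 0$ and $0<\rho<1$ with $\|X_n-X^*\|\le K\rho^n$ for all $n\ge 0$. A fixed point $X^*$ of $T$ is locally asymptotically stable if it is Lyapunov stable (for every neighborhood $V$ of $X^*$ there is a neighborhood $W$ of $X^*$ such that all iterates of every point of $W$ are defined and stay in $V$) and there is a neighborhood of $X^*$ such that the iterates of every point of it are defined and converge to $X^*$. *)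

theory Defs
  imports "HOL-Analysis.Analysis"
begin

type_synonym point = "real ^ 2"

text \<open>Center and radius; in a state the radius may be nonpositive.\<close>
type_synonym circle = "point \<times> real"

text \<open>The norm on binary products is \<open>sqrt ((norm x)\<^sup>2 + (norm y)\<^sup>2)\<close>, so the norm on states is the
  Euclidean norm of the nine coordinates.\<close>
type_synonym state = "circle \<times> circle \<times> circle"

definition line_through :: "point \<Rightarrow> point \<Rightarrow> point set" where
  "line_through A B = affine hull {A, B}"

text \<open>The line through the side touches the circle, and the point of contact lies on the side.\<close>
definition tangent_to_side :: "circle \<Rightarrow> point \<Rightarrow> point \<Rightarrow> bool" where
  "tangent_to_side c A B \<longleftrightarrow>
     (\<exists>S. sphere (fst c) (snd c) \<inter> line_through A B = {S} \<and> S \<in> closed_segment A B)"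

definition externally_tangent :: "circle \<Rightarrow> circle \<Rightarrow> bool" where
  "externally_tangent c c' \<longleftrightarrow>
     (\<exists>S. sphere (fst c) (snd c) \<inter> sphere (fst c') (snd c') = {S}) \<and>
     ball (fst c) (snd c) \<inter> ball (fst c') (snd c') = {}"

definition is_malfatti :: "point \<Rightarrow> point \<Rightarrow> point \<Rightarrow> state \<Rightarrow> bool" where
  "is_malfatti A B C X \<longleftrightarrow> (case X of (c1, c2, c3) \<Rightarrow>
     (\<forall>c \<in> {c1, c2, c3}. snd c > 0 \<and> sphere (fst c) (snd c) \<subseteq> convex hull {A, B, C}) \<and>
     tangent_to_side c1 A B \<and> tangent_to_side c1 A C \<and>
     tangent_to_side c2 A B \<and> tangent_to_side c2 B C \<and>
     tangent_to_side c3 B C \<and> tangent_to_side c3 C A \<and>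
     externally_tangent c1 c2 \<and> externally_tangent c2 c3 \<and> externally_tangent c1 c3)"

text \<open>For a line \<open>L\<close> and \<open>P \<notin> L\<close>, the nearest point of \<open>L\<close> is the foot of the perpendicular from \<open>P\<close>,
  so \<open>n\<close> below is the unit normal of \<open>L\<close> pointing from \<open>L\<close> toward \<open>P\<close>.\<close>
definition lc_correction :: "real \<Rightarrow> point set \<Rightarrow> circle \<Rightarrow> circle" where
  "lc_correction q L c = (case c of (P, r) \<Rightarrow>
     let d = r - infdist P L;
         n = sgn (P - closest_point L P)
     in (((1 - q) * d / 2) *\<^sub>R n, - ((1 - q) * d / 2)))"

text \<open>The pair of corrections for the first and for the second circle.\<close>
definition cc_correction :: "real \<Rightarrow> circle \<Rightarrow> circle \<Rightarrow> circle \<times> circle" where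
  "cc_correction q c c' = (case (c, c') of ((P, r), (P', r')) \<Rightarrow>
     let d = norm (P' - P) - r - r';
         u = (P' - P) /\<^sub>R norm (P' - P);
         e = (1 - q) / 4 * d
     in ((e *\<^sub>R u, e), (- (e *\<^sub>R u), e)))"

definition update_domain :: "point \<Rightarrow> point \<Rightarrow> point \<Rightarrow> state set" where
  "update_domain A B C = {((P1, r1), (P2, r2), (P3, r3)) | P1 r1 P2 r2 P3 r3.
     P1 \<notin> line_through A B \<and> P1 \<notin> line_through A C \<and>
     P2 \<notin> line_through A B \<and> P2 \<notin> line_through B C \<and>
     P3 \<notin> line_through B C \<and> P3 \<notin> line_through C A \<and>
     P1 \<noteq> P2 \<and> P2 \<noteq> P3 \<and> P1 \<noteq> P3}"

text \<open>As a HOL function this is total; its values are meaningful only on \<^const>\<open>update_domain\<close>.\<close>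
definition update_map :: "real \<Rightarrow> point \<Rightarrow> point \<Rightarrow> point \<Rightarrow> state \<Rightarrow> state" where
  "update_map q A B C X = (case X of (c1, c2, c3) \<Rightarrow>
     (c1 + lc_correction q (line_through A B) c1 + lc_correction q (line_through A C) c1
         + fst (cc_correction q c1 c2) + fst (cc_correction q c1 c3),
      c2 + lc_correction q (line_through A B) c2 + lc_correction q (line_through B C) c2
         + snd (cc_correction q c1 c2) + fst (cc_correction q c2 c3),
      c3 + lc_correction q (line_through B C) c3 + lc_correction q (line_through C A) c3
         + snd (cc_correction q c2 c3) + snd (cc_correction q c1 c3)))"

definition converges_geometrically :: "(nat \<Rightarrow> 'a::real_normed_vector) \<Rightarrow> 'a \<Rightarrow> bool" where
  "converges_geometrically x l \<longleftrightarrow>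
     (\<exists>K \<rho>. K \<ge> 0 \<and> 0 < \<rho> \<and> \<rho> < 1 \<and> (\<forall>n. norm (x n - l) \<le> K * \<rho> ^ n))"

text \<open>A partial map is modelled by a total function \<open>T\<close> together with its domain \<open>D\<close>.\<close>
definition iterates_defined :: "'a set \<Rightarrow> ('a \<Rightarrow> 'a) \<Rightarrow> 'a \<Rightarrow> bool" where
  "iterates_defined D T x \<longleftrightarrow> (\<forall>n. (T ^^ n) x \<in> D)"

definition fixed_point_on :: "'a set \<Rightarrow> ('a \<Rightarrow> 'a) \<Rightarrow> 'a \<Rightarrow> bool" where
  "fixed_point_on D T x \<longleftrightarrow> x \<in> D \<and> T x = x"

definition lyapunov_stable :: "'a::topological_space set \<Rightarrow> ('a \<Rightarrow> 'a) \<Rightarrow> 'a \<Rightarrow> bool" where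
  "lyapunov_stable D T x \<longleftrightarrow>
     (\<forall>V. open V \<and> x \<in> V \<longrightarrow>
       (\<exists>W. open W \<and> x \<in> W \<and>
         (\<forall>y\<in>W. iterates_defined D T y \<and> (\<forall>n. (T ^^ n) y \<in> V))))"

definition locally_asymptotically_stable ::
    "'a::topological_space set \<Rightarrow> ('a \<Rightarrow> 'a) \<Rightarrow> 'a \<Rightarrow> bool" where
  "locally_asymptotically_stable D T x \<longleftrightarrow>
     lyapunov_stable D T x \<and>
     (\<exists>W. open W \<and> x \<in> W \<and>
       (\<forall>y\<in>W. iterates_defined D T y \<and> (\<lambda>n. (T ^^ n) y) \<longlonglongrightarrow> x))"

end

theory Submission
  imports Defs
begin

text \<open>Each module moves the state by \<open>-(1 - q) d g / \<parallel>g\<parallel>\<^sup>2\<close>, where \<open>d\<close> is its contact error and \<open>g\<close> is the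
  gradient of \<open>d\<close>. As all errors vanish at the Malfatti configuration, the derivative of the update map
  there is \<open>I - M\<close> with \<open>M = (1 - q) \<Sum> g g\<^sup>T / \<parallel>g\<parallel>\<^sup>2\<close>, and \<open>M\<close> is positive semidefinite with trace
  \<open>9 (1 - q) < 2\<close>. Hence \<open>I - M\<close> is a strict contraction as soon as the nine gradients span, that is, as
  soon as the configuration is infinitesimally rigid. For rigidity, the line contacts force each circle
  to be scaled about its vertex of the triangle, and then each circle contact forces two of the radii to
  change with opposite signs; around the three-cycle of contacts this is impossible unless nothing
  moves.\<close>

subsection \<open>Stability from the derivative\<close>

text \<open>Pointwise strictness becomes a uniform factor because the unit sphere is compact in
  finite dimension: the factor is the maximum of \<open>norm (L v)\<close> over it, attained at some
  \<open>w\<close> and hence below 1.\<close>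

lemma linear_contraction_factor:
  fixes L :: "'a::euclidean_space \<Rightarrow> 'a"
  assumes "bounded_linear L" and less: "\<And>v. v \<noteq> 0 \<Longrightarrow> norm (L v) < norm v"
  obtains k where "0 \<le> k" "k < 1" "\<And>v. norm (L v) \<le> k * norm v"
proof -
  interpret bounded_linear L by fact
  have "compact (sphere (0::'a) 1)" "sphere (0::'a) 1 \<noteq> {}"
    by auto
  moreover have "continuous_on (sphere 0 1) (\<lambda>v. norm (L v))"
    by (intro continuous_intros linear_continuous_on assms(1))
  ultimately obtain w where w: "w \<in> sphere 0 1"
    and max: "\<And>v. v \<in> sphere 0 1 \<Longrightarrow> norm (L v) \<le> norm (L w)"
    using continuous_attains_sup by metis
  show thesis
  proof
    show "0 \<le> norm (L w)" by simp
    show "norm (L w) < 1" using less[of w] w by force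
    fix v
    show "norm (L v) \<le> norm (L w) * norm v"
    proof (cases "v = 0")
      case False
      with max[of "v /\<^sub>R norm v"] show ?thesis
        by (simp add: scaleR field_simps)
    qed (simp add: zero)
  qed
qed

text \<open>The contraction estimate is known on the ball only, so invariance of the ball and
  geometric decay go through one induction.\<close>

lemma iterates_contraction:
  fixes T :: "'a::real_normed_vector \<Rightarrow> 'a"
  assumes "0 \<le> \<rho>" "\<rho> \<le> 1"
    and contr: "\<And>y. y \<in> ball x \<delta> \<Longrightarrow> norm (T y - x) \<le> \<rho> * norm (y - x)"
    and y: "y \<in> ball x \<delta>"
  shows "(T ^^ n) y \<in> ball x \<delta> \<and> norm ((T ^^ n) y - x) \<le> norm (y - x) * \<rho> ^ n"
proof (induction n)
  case (Suc n)
  let ?z = "(T ^^ n) y"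
  have le: "norm (T ?z - x) \<le> \<rho> * norm (?z - x)"
    using Suc contr by blast
  also have "\<dots> \<le> \<rho> * (norm (y - x) * \<rho> ^ n)"
    using Suc \<open>0 \<le> \<rho>\<close> by (intro mult_left_mono) auto
  finally have "norm (T ?z - x) \<le> norm (y - x) * \<rho> ^ Suc n"
    by (simp add: algebra_simps)
  moreover have "\<rho> * norm (?z - x) \<le> norm (?z - x)"
    using \<open>\<rho> \<le> 1\<close> by (simp add: mult_left_le_one_le \<open>0 \<le> \<rho>\<close>)
  with le Suc have "T ?z \<in> ball x \<delta>"
    by (simp add: dist_norm norm_minus_commute)
  ultimately show ?case by simp
qed (use y in auto)

lemma converges_geometrically_imp_LIMSEQ:
  assumes "converges_geometrically X l"
  shows "X \<longlonglongrightarrow> l"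
proof -
  obtain K \<rho> where "0 < \<rho>" "\<rho> < 1" and le: "\<And>n. norm (X n - l) \<le> K * \<rho> ^ n"
    using assms unfolding converges_geometrically_def by blast
  then have "(\<lambda>n. K * \<rho> ^ n) \<longlonglongrightarrow> 0"
    by (intro tendsto_mult_right_zero LIMSEQ_realpow_zero) auto
  then have "(\<lambda>n. X n - l) \<longlonglongrightarrow> 0"
    by (rule Lim_null_comparison[rotated]) (simp add: le)
  then show ?thesis
    by (simp add: LIM_zero_iff)
qed

text \<open>Near \<open>x\<close> the map differs from its linearisation by a small multiple of the
  distance to \<open>x\<close>. Since \<open>L\<close> contracts in the given norm itself, all small
  balls around \<open>x\<close> are invariant.\<close>

lemma locally_asymptotically_stable_derivative:
  fixes T :: "'a::euclidean_space \<Rightarrow> 'a"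
  assumes "open D" "x \<in> D" "T x = x"
    and deriv: "(T has_derivative L) (at x)"
    and less: "\<And>v. v \<noteq> 0 \<Longrightarrow> norm (L v) < norm v"
  shows "\<exists>U. open U \<and> x \<in> U \<and>
      (\<forall>y\<in>U. iterates_defined D T y \<and> converges_geometrically (\<lambda>n. (T ^^ n) y) x)"
    and "locally_asymptotically_stable D T x"
proof -
  obtain k where k: "0 \<le> k" "k < 1" "\<And>v. norm (L v) \<le> k * norm v"
    using linear_contraction_factor[OF has_derivative_bounded_linear[OF deriv] less] by blast
  \<comment> \<open>Halfway between \<open>k\<close> and 1: the gap \<open>\<rho> - k\<close>
    absorbs the remainder of the derivative, and \<open>\<rho>\<close> is positive even when
    \<open>k = 0\<close>, as geometric convergence demands.\<close>
  define \<rho> where "\<rho> = (1 + k) / 2"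
  have \<rho>: "0 < \<rho>" "\<rho> < 1" "0 < \<rho> - k"
    using k by (auto simp: \<rho>_def)
  then obtain \<delta> where "\<delta> > 0" and
    \<delta>: "\<And>y. norm (y - x) < \<delta> \<Longrightarrow> norm (T y - T x - L (y - x)) \<le> (\<rho> - k) * norm (y - x)"
    using deriv unfolding has_derivative_at_alt by blast
  have contr: "norm (T y - x) \<le> \<rho> * norm (y - x)" if "y \<in> ball x \<delta>" for y
  proof -
    have "norm (T y - x) \<le> norm (T y - T x - L (y - x)) + norm (L (y - x))"
      using norm_triangle_ineq[of "T y - T x - L (y - x)" "L (y - x)"] \<open>T x = x\<close> by simp
    also have "\<dots> \<le> (\<rho> - k) * norm (y - x) + k * norm (y - x)"
      using that by (intro add_mono \<delta> k) (simp add: dist_norm norm_minus_commute)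
    finally show ?thesis by (simp add: algebra_simps)
  qed
  \<comment> \<open>Balls of this kind exist inside every neighbourhood of \<open>x\<close>, so they
    serve for geometric convergence, for Lyapunov stability and for attraction alike.\<close>
  have ball: "\<exists>\<epsilon>>0. ball x \<epsilon> \<subseteq> V \<and> (\<forall>y\<in>ball x \<epsilon>. iterates_defined D T y \<and>
      (\<forall>n. (T ^^ n) y \<in> ball x \<epsilon>) \<and> converges_geometrically (\<lambda>n. (T ^^ n) y) x)"
    if V: "open V" "x \<in> V" for V
  proof -
    have "open (V \<inter> D \<inter> ball x \<delta>)" "x \<in> V \<inter> D \<inter> ball x \<delta>"
      using assms V \<open>\<delta> > 0\<close> by auto
    then obtain \<epsilon> where "\<epsilon> > 0" and \<epsilon>: "ball x \<epsilon> \<subseteq> V \<inter> D \<inter> ball x \<delta>"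
      using open_contains_ball by blast
    have it: "(T ^^ n) y \<in> ball x \<epsilon> \<and> norm ((T ^^ n) y - x) \<le> norm (y - x) * \<rho> ^ n"
      if "y \<in> ball x \<epsilon>" for y n
      using \<rho> \<epsilon> that by (intro iterates_contraction contr) auto
    have "iterates_defined D T y \<and>
        (\<forall>n. (T ^^ n) y \<in> ball x \<epsilon>) \<and> converges_geometrically (\<lambda>n. (T ^^ n) y) x"
      if "y \<in> ball x \<epsilon>" for y
      unfolding iterates_defined_def converges_geometrically_def
      using it[OF that] \<epsilon> \<rho> by (blast intro: norm_ge_zero)
    then show ?thesis using \<open>\<epsilon> > 0\<close> \<epsilon> by blast
  qed
  show "\<exists>U. open U \<and> x \<in> U \<and>
      (\<forall>y\<in>U. iterates_defined D T y \<and> converges_geometrically (\<lambda>n. (T ^^ n) y) x)"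
    using ball[of UNIV] by (meson UNIV_I centre_in_ball open_UNIV open_ball)
  then show "locally_asymptotically_stable D T x"
    unfolding locally_asymptotically_stable_def lyapunov_stable_def
    using ball by (meson centre_in_ball converges_geometrically_imp_LIMSEQ open_ball subsetD)
qed

text \<open>With \<open>M\<close>, \<open>Q\<close> and the trace \<open>s\<close> as in the proof,
  the squared norm of \<open>v - M\<close> is that of \<open>v\<close> minus \<open>2 * Q\<close>
  plus that of \<open>M\<close>. Cauchy-Schwarz bounds the last term by \<open>Q * s\<close>, and
  \<open>s < 2\<close> while \<open>Q > 0\<close>.\<close>

lemma norm_minus_weighted_projections_less:
  fixes g :: "'i \<Rightarrow> 'a::real_inner"
  assumes "finite I" and c: "\<And>i. i \<in> I \<Longrightarrow> 0 < c i"
    and S: "(\<Sum>i\<in>I. c i * (g i \<bullet> g i)) < 2"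
    and "\<exists>i\<in>I. g i \<bullet> v \<noteq> 0"
  shows "norm (v - (\<Sum>i\<in>I. (c i * (g i \<bullet> v)) *\<^sub>R g i)) < norm v"
proof -
  define M where "M = (\<Sum>i\<in>I. (c i * (g i \<bullet> v)) *\<^sub>R g i)"
  define Q where "Q = (\<Sum>i\<in>I. c i * (g i \<bullet> v)\<^sup>2)"
  define s where "s = (\<Sum>i\<in>I. c i * (g i \<bullet> g i))"
  obtain j where "j \<in> I" "g j \<bullet> v \<noteq> 0" using assms by blast
  then have "Q > 0"
    unfolding Q_def using \<open>finite I\<close> c
    by (intro sum_pos2[of I j]) (auto simp: less_imp_le)
  have "M \<bullet> v = Q"
    by (simp add: M_def Q_def inner_sum_left power2_eq_square algebra_simps)
  have "norm M \<le> (\<Sum>i\<in>I. norm ((c i * (g i \<bullet> v)) *\<^sub>R g i))"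
    unfolding M_def by (rule norm_sum)
  \<comment> \<open>Each weight is split into two square roots, so that Cauchy-Schwarz separates
    \<open>Q\<close> from \<open>s\<close>.\<close>
  also have "\<dots> = (\<Sum>i\<in>I. (sqrt (c i) * \<bar>g i \<bullet> v\<bar>) * (sqrt (c i) * norm (g i)))"
  proof (rule sum.cong)
    fix i assume "i \<in> I"
    then have "c i = sqrt (c i) * sqrt (c i)" using c[of i] by simp
    then show "norm ((c i * (g i \<bullet> v)) *\<^sub>R g i) =
        (sqrt (c i) * \<bar>g i \<bullet> v\<bar>) * (sqrt (c i) * norm (g i))"
      using c[OF \<open>i \<in> I\<close>] by (simp add: abs_mult)
  qed simp
  finally have "(norm M)\<^sup>2 \<le>
      (\<Sum>i\<in>I. (sqrt (c i) * \<bar>g i \<bullet> v\<bar>) * (sqrt (c i) * norm (g i)))\<^sup>2"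
    by (intro power_mono) auto
  also have "\<dots> \<le> (\<Sum>i\<in>I. (sqrt (c i) * \<bar>g i \<bullet> v\<bar>)\<^sup>2) * (\<Sum>i\<in>I. (sqrt (c i) * norm (g i))\<^sup>2)"
    by (rule Cauchy_Schwarz_ineq_sum)
  also have "\<dots> = Q * s"
    unfolding Q_def s_def using c
    by (auto intro!: arg_cong2[of _ _ _ _ "(*)"] sum.cong
        simp: power_mult_distrib less_imp_le power2_norm_eq_inner)
  finally have "(norm M)\<^sup>2 \<le> Q * s" .
  also have "\<dots> < Q * 2" using S \<open>Q > 0\<close> by (simp add: s_def)
  finally have "(norm (v - M))\<^sup>2 < (norm v)\<^sup>2"
    using \<open>M \<bullet> v = Q\<close>
    by (simp add: power2_norm_eq_inner inner_diff_left inner_diff_right inner_commute)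
  then show ?thesis unfolding M_def by (simp add: power2_less_imp_less)
qed

subsection \<open>Circles tangent to the sides of a triangle\<close>

text \<open>For centers on the side of \<open>C\<close>, the distance to the line is the affine
  function \<open>n \<bullet> (P - A)\<close>; this removes absolute values and nearest points from
  the line modules.\<close>

definition inward_normal :: "point \<Rightarrow> point \<Rightarrow> point \<Rightarrow> point \<Rightarrow> bool" where
  "inward_normal A B C n \<longleftrightarrow> A \<noteq> B \<and> norm n = 1 \<and> n \<bullet> (B - A) = 0 \<and> 0 < n \<bullet> (C - A)"

lemma inward_normal_commute: "inward_normal A B C n \<longleftrightarrow> inward_normal B A C n"
  unfolding inward_normal_def by (auto simp: inner_diff_right)

lemma line_through_commute: "line_through A B = line_through B A"
  by (simp add: line_through_def insert_commute)

lemma tangent_to_side_commute: "tangent_to_side c A B \<longleftrightarrow> tangent_to_side c B A"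
  by (simp add: tangent_to_side_def line_through_commute closed_segment_commute)

text \<open>Parseval's identity for the orthogonal directions \<open>e\<close> and \<open>n\<close>
  of the plane, cleared of the denominator \<open>e \<bullet> e\<close>.\<close>

lemma inner_orthogonal_decomposition:
  fixes e n x y :: point
  assumes "norm n = 1" "n \<bullet> e = 0"
  shows "(e \<bullet> e) * (x \<bullet> y) = (x \<bullet> e) * (y \<bullet> e) + (e \<bullet> e) * (x \<bullet> n) * (y \<bullet> n)"
proof -
  have 1: "(n$1)\<^sup>2 + (n$2)\<^sup>2 = 1"
    using assms(1) by (simp add: norm_eq_1 inner_vec_def sum_2 power2_eq_square)
  have 2: "n$1 * e$1 + n$2 * e$2 = 0"
    using assms(2) by (simp add: inner_vec_def sum_2)
  \<comment> \<open>The signed length of \<open>e\<close>: in the plane, \<open>e\<close> is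
    \<open>l\<close> times the quarter turn of \<open>n\<close>.\<close>
  define l where "l = e$2 * n$1 - e$1 * n$2"
  have e: "e$1 = - l * n$2" "e$2 = l * n$1"
    using 1 2 unfolding l_def by algebra+
  show ?thesis
    using 1 unfolding inner_vec_def sum_2 inner_real_def e by algebra
qed

text \<open>A quarter turn \<open>m\<close> of \<open>B - A\<close> is normalised and oriented. Its
  pairing with \<open>C - A\<close> is the determinant of the two edge vectors, nonzero because the
  vertices are not collinear.\<close>

lemma exists_inward_normal:
  assumes "\<not> collinear {A, B, C}"
  obtains n where "inward_normal A B C n"
proof -
  define e where "e = B - A"
  define m :: point where "m = vector [- e$2, e$1]"
  have m: "m$1 = - e$2" "m$2 = e$1" by (auto simp: m_def)
  have "m \<bullet> e = 0" by (simp add: inner_vec_def sum_2 m)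
  have "e \<noteq> 0" using assms by (auto simp: e_def)
  then have "m \<noteq> 0" using m by (auto simp: vec_eq_iff forall_2)
  have "m \<bullet> (C - A) \<noteq> 0"
  proof
    assume "m \<bullet> (C - A) = 0"
    then have *: "e$1 * (C - A)$2 = e$2 * (C - A)$1"
      by (simp add: inner_vec_def sum_2 m algebra_simps)
    have "\<exists>t. C - A = t *\<^sub>R e"
    proof (cases "e$1 = 0")
      case True
      with \<open>e \<noteq> 0\<close> have "e$2 \<noteq> 0" by (auto simp: vec_eq_iff forall_2)
      with * True show ?thesis
        by (intro exI[of _ "(C - A)$2 / e$2"]) (auto simp: vec_eq_iff forall_2)
    next
      case False
      with * show ?thesis
        by (intro exI[of _ "(C - A)$1 / e$1"]) (auto simp: vec_eq_iff forall_2 field_simps)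
    qed
    then have "collinear {B, A, C}"
      by (subst collinear_3) (auto simp: collinear_lemma e_def)
    then show False using assms by (simp add: insert_commute)
  qed
  then have "inward_normal A B C (sgn (m \<bullet> (C - A)) *\<^sub>R sgn m)"
    using \<open>m \<noteq> 0\<close> \<open>m \<bullet> e = 0\<close> \<open>e \<noteq> 0\<close>
    by (auto simp: inward_normal_def norm_sgn sgn_div_norm e_def abs_mult sgn_if
        zero_less_mult_iff mult_less_0_iff)
  then show thesis by (rule that)
qed

lemma line_through_eq_hyperplane:
  assumes "inward_normal A B C n"
  shows "line_through A B = {x. n \<bullet> (x - A) = 0}"
proof -
  have n: "A \<noteq> B" "norm n = 1" "n \<bullet> (B - A) = 0"
    using assms by (auto simp: inward_normal_def)
  define e where "e = B - A"
  have e: "e \<noteq> 0" "n \<bullet> e = 0" using n by (auto simp: e_def)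
  have "\<exists>t. x = A + t *\<^sub>R e" if "n \<bullet> (x - A) = 0" for x
  proof -
    \<comment> \<open>The part of \<open>x - A\<close> orthogonal to \<open>e\<close>. It is
      orthogonal to \<open>n\<close> as well, hence zero.\<close>
    define y where "y = (x - A) - (((x - A) \<bullet> e) / (e \<bullet> e)) *\<^sub>R e"
    have "y \<bullet> e = 0" "y \<bullet> n = 0"
      using e that unfolding y_def by (simp_all add: inner_diff inner_commute)
    with inner_orthogonal_decomposition[OF n(2) e(2), of y y] e have "y = 0"
      by simp
    then show ?thesis
      unfolding y_def by (metis add.commute diff_add_cancel eq_iff_diff_eq_0)
  qed
  moreover have "n \<bullet> (A + t *\<^sub>R e - A) = 0" for t
    using e by simp
  moreover have "line_through A B = range (\<lambda>t. A + t *\<^sub>R e)"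
    unfolding line_through_def affine_hull_2_alt e_def by blast
  ultimately show ?thesis by auto
qed

text \<open>Otherwise the mirror image \<open>S'\<close> of \<open>S\<close> in the foot of the
  perpendicular from \<open>P\<close> would be a second common point.\<close>

lemma orthogonal_if_sphere_line_singleton:
  assumes "sphere P r \<inter> line_through A B = {S}"
  shows "(P - S) \<bullet> (B - A) = 0"
proof (rule ccontr)
  assume *: "(P - S) \<bullet> (B - A) \<noteq> 0"
  define e where "e = B - A"
  define t where "t = 2 * ((P - S) \<bullet> e) / (e \<bullet> e)"
  have "e \<noteq> 0" "t \<noteq> 0" using * by (auto simp: t_def e_def)
  define S' where "S' = S + t *\<^sub>R e"
  have S: "S \<in> line_through A B" "dist P S = r" using assms by auto
  have "S' \<in> line_through A B"
  proof -
    obtain u where "S = A + u *\<^sub>R e"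
      using S(1) unfolding line_through_def affine_hull_2_alt e_def by auto
    then have "S' = A + (u + t) *\<^sub>R e" by (simp add: S'_def algebra_simps)
    then show ?thesis unfolding line_through_def affine_hull_2_alt e_def by auto
  qed
  moreover have "norm (P - S') = norm (P - S)"
  proof -
    have "(P - S') \<bullet> (P - S') = (P - S) \<bullet> (P - S) - 2 * t * ((P - S) \<bullet> e) + t * t * (e \<bullet> e)"
      by (simp add: S'_def inner_diff_left inner_diff_right inner_add_left inner_add_right
          inner_commute algebra_simps)
    also have "\<dots> = (P - S) \<bullet> (P - S)"
      using \<open>e \<noteq> 0\<close> by (simp add: t_def field_simps)
    finally show ?thesis by (simp add: norm_eq)
  qed
  then have "S' \<in> sphere P r" using S(2) by (simp add: dist_norm)
  ultimately have "S' \<in> {S}" using assms by (metis IntI)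
  then have "S' = S" by simp
  then show False using \<open>e \<noteq> 0\<close> \<open>t \<noteq> 0\<close> by (simp add: S'_def)
qed

text \<open>The point \<open>P - r *\<^sub>R n\<close> of the circle must still lie in the
  half-plane bounded by the line \<open>AB\<close> that contains the triangle.\<close>

lemma sphere_in_triangle_clearance:
  assumes n: "inward_normal A B C n" and "0 \<le> r"
    and sub: "sphere P r \<subseteq> convex hull {A, B, C}"
  shows "r \<le> n \<bullet> (P - A)"
proof -
  have "convex hull {A, B, C} \<subseteq> {x. n \<bullet> A \<le> n \<bullet> x}"
    using n by (intro hull_minimal convex_halfspace_ge)
      (auto simp: inward_normal_def inner_diff_right)
  moreover have "P - r *\<^sub>R n \<in> sphere P r"
    using n \<open>0 \<le> r\<close> by (simp add: inward_normal_def dist_norm)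
  ultimately have "n \<bullet> A \<le> n \<bullet> (P - r *\<^sub>R n)"
    using sub by blast
  moreover have "n \<bullet> n = 1" using n by (simp add: inward_normal_def norm_eq_1)
  ultimately show ?thesis by (simp add: inner_diff_right)
qed

text \<open>Tangency determines \<open>n \<bullet> (P - A)\<close> up to sign, and containment in
  the triangle selects the sign. The second claim holds because the foot of \<open>P\<close> is the
  contact point, which lies on the side.\<close>

lemma tangent_to_side_contact:
  assumes n: "inward_normal A B C n" and "0 < r"
    and sub: "sphere P r \<subseteq> convex hull {A, B, C}"
    and tan: "tangent_to_side (P, r) A B"
  shows "n \<bullet> (P - A) = r" "0 \<le> (P - A) \<bullet> (B - A)"
proof -
  obtain S where S: "sphere P r \<inter> line_through A B = {S}" "S \<in> closed_segment A B"
    using tan by (auto simp: tangent_to_side_def)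
  have orth: "(P - S) \<bullet> (B - A) = 0"
    using S(1) by (rule orthogonal_if_sphere_line_singleton)
  have "S \<in> sphere P r" using S(1) by blast
  then have PS: "(P - S) \<bullet> (P - S) = r\<^sup>2"
    by (simp add: dist_norm power2_norm_eq_inner[symmetric])
  have "S \<in> line_through A B" using S(1) by blast
  then have nS: "n \<bullet> (S - A) = 0"
    unfolding line_through_eq_hyperplane[OF n] by simp
  have n': "norm n = 1" "n \<bullet> (B - A) = 0" "B - A \<noteq> 0"
    using n by (auto simp: inward_normal_def)
  from inner_orthogonal_decomposition[OF n'(1,2), of "P - S" "P - S"] orth n'(3) PS
  have "((P - S) \<bullet> n)\<^sup>2 = r\<^sup>2"
    by (auto simp: power2_eq_square)
  moreover have "(P - S) \<bullet> n = n \<bullet> (P - A)"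
    using nS by (simp add: inner_diff_right inner_diff_left inner_commute)
  ultimately have "\<bar>n \<bullet> (P - A)\<bar> = \<bar>r\<bar>" by (simp add: power2_eq_iff abs_eq_iff)
  moreover have "r \<le> n \<bullet> (P - A)"
    using sphere_in_triangle_clearance[OF n _ sub] \<open>0 < r\<close> by simp
  ultimately show "n \<bullet> (P - A) = r" using \<open>0 < r\<close> by simp
  obtain u where "0 \<le> u" "S = A + u *\<^sub>R (B - A)"
    using S(2) by (auto simp: in_segment algebra_simps)
  then have "(P - A) \<bullet> (B - A) = u * ((B - A) \<bullet> (B - A))"
    using orth by (simp add: inner_diff_left inner_add_left)
  then show "0 \<le> (P - A) \<bullet> (B - A)" using \<open>0 \<le> u\<close> by simp
qed

lemma externally_tangent_dist:
  assumes "externally_tangent (P, r) (P', r')" "0 < r" "0 < r'"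
  shows "norm (P' - P) = r + r'"
proof -
  obtain S where S: "sphere P r \<inter> sphere P' r' = {S}"
    and disj: "ball P r \<inter> ball P' r' = {}"
    using assms(1) unfolding externally_tangent_def fst_conv snd_conv by (elim conjE exE)
  from S have "S \<in> sphere P r \<inter> sphere P' r'" by (metis insertI1)
  then have "S \<in> sphere P r" "S \<in> sphere P' r'" by (metis IntD1, metis IntD2)
  then have "dist P P' \<le> r + r'"
    using dist_triangle[of P P' S] by (simp add: dist_commute)
  moreover have "r + r' \<le> dist P P'"
  proof (rule ccontr)
    assume less: "\<not> r + r' \<le> dist P P'"
    \<comment> \<open>\<open>Z\<close> divides the segment between the centers in the ratio
      \<open>r : r'\<close>; if the centers were too close, it would lie in both open discs.\<close>
    define t where "t = r / (r + r')"
    have t: "0 < t" "t < 1" using assms by (auto simp: t_def)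
    define Z where "Z = P + t *\<^sub>R (P' - P)"
    have "dist P Z = t * dist P P'"
      using t by (simp add: Z_def dist_norm norm_minus_commute)
    also have "\<dots> < t * (r + r')" using t less by simp
    finally have "Z \<in> ball P r" using assms by (simp add: t_def)
    have "P' - Z = (1 - t) *\<^sub>R (P' - P)" by (simp add: Z_def algebra_simps)
    then have "dist P' Z = (1 - t) * dist P P'"
      using t by (simp add: dist_norm norm_minus_commute)
    also have "\<dots> < (1 - t) * (r + r')" using t less by simp
    also have "\<dots> = r'" using assms by (simp add: t_def field_simps)
    finally have "Z \<in> ball P' r'" by simp
    with \<open>Z \<in> ball P r\<close> disj show False by blast
  qed
  ultimately show ?thesis by (simp add: dist_norm norm_minus_commute)
qed

subsection \<open>Infinitesimal rigidity\<close>

text \<open>The first vertex is the corner. All three Malfatti circles are instances under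
  permutation of the vertices, so facts are proved for one corner only.\<close>

definition corner_circle :: "point \<Rightarrow> point \<Rightarrow> point \<Rightarrow> circle \<Rightarrow> bool" where
  "corner_circle A B C c \<longleftrightarrow> 0 < snd c \<and> sphere (fst c) (snd c) \<subseteq> convex hull {A, B, C} \<and>
     tangent_to_side c A B \<and> tangent_to_side c A C"

lemma corner_circle_commute: "corner_circle A B C c \<longleftrightarrow> corner_circle A C B c"
  by (auto simp: corner_circle_def insert_commute)

lemma corner_circle_contact:
  assumes "corner_circle A B C (P, r)" "inward_normal A B C n"
  shows "n \<bullet> (P - A) = r" "0 \<le> (P - A) \<bullet> (B - A)"
  using assms tangent_to_side_contact[of A B C n r P] by (auto simp: corner_circle_def)

lemma corner_circle_clearance:
  assumes "corner_circle A B C (P, r)" "inward_normal B C A n"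
  shows "r \<le> n \<bullet> (P - B)"
  using assms sphere_in_triangle_clearance[of B C A n r P]
  by (auto simp: corner_circle_def insert_commute)

text \<open>Both normals take the value \<open>r\<close> on \<open>P - A\<close> and the value
  \<open>s\<close> on \<open>p\<close>, and they are linearly independent, so \<open>p\<close> must
  be the corresponding multiple of \<open>P - A\<close>.\<close>

lemma corner_motion:
  assumes n: "inward_normal A B C n" and m: "inward_normal A C B m"
    and c: "corner_circle A B C (P, r)"
    and p: "n \<bullet> p = s" "m \<bullet> p = s"
  shows "p = (s / r) *\<^sub>R (P - A)"
proof -
  have "r > 0" using c by (simp add: corner_circle_def)
  have nm: "n \<bullet> (P - A) = r" "m \<bullet> (P - A) = r"
    using corner_circle_contact c n m corner_circle_commute by blast+
  define e where "e = B - A"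
  define w where "w = p - (s / r) *\<^sub>R (P - A)"
  have w: "n \<bullet> w = 0" "m \<bullet> w = 0"
    unfolding w_def inner_diff_right[of _ p] inner_scaleR_right nm p using \<open>r > 0\<close> by auto
  have e: "norm n = 1" "n \<bullet> e = 0" "e \<noteq> 0" "m \<bullet> e > 0"
    using n m by (auto simp: inward_normal_def e_def)
  \<comment> \<open>As \<open>w\<close> is orthogonal to \<open>n\<close>, the decomposition of
    \<open>m \<bullet> w = 0\<close> leaves only the product of \<open>m \<bullet> e > 0\<close> and
    \<open>w \<bullet> e\<close>.\<close>
  have "w \<bullet> e = 0"
    using inner_orthogonal_decomposition[OF e(1,2), of m w] e w by (simp add: inner_commute)
  then have "w = 0"
    using inner_orthogonal_decomposition[OF e(1,2), of w w] e w by (simp add: inner_commute)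
  then show ?thesis by (simp add: w_def)
qed

text \<open>Suppose \<open>x \<bullet> e < 0\<close> for \<open>e = B - A\<close>. Since
  \<open>m \<bullet> e > 0\<close>, the first inequality forces \<open>n \<bullet> x < 0\<close>;
  since \<open>k \<bullet> e < 0\<close>, the second forces
  \<open>(n \<bullet> x) * (1 - k \<bullet> n) > 0\<close>, a contradiction.\<close>

lemma nonneg_along_side:
  assumes n: "inward_normal A B C n" and m: "inward_normal A C B m" and k: "inward_normal B C A k"
    and "n \<bullet> x \<le> m \<bullet> x" "k \<bullet> x \<le> n \<bullet> x"
  shows "0 \<le> x \<bullet> (B - A)"
proof (rule ccontr)
  define e where "e = B - A"
  assume "\<not> 0 \<le> x \<bullet> (B - A)"
  then have D: "x \<bullet> e < 0" by (simp add: e_def)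
  have "e \<noteq> 0" using n by (auto simp: inward_normal_def e_def)
  then have e: "norm n = 1" "n \<bullet> e = 0" "e \<bullet> e > 0" "m \<bullet> e > 0" "k \<bullet> e < 0"
    using n m k by (auto simp: inward_normal_def e_def inner_diff_right[of k])
  have le: "m \<bullet> n \<le> 1" "k \<bullet> n \<le> 1"
    using norm_cauchy_schwarz[of m n] norm_cauchy_schwarz[of k n] n m k
    by (auto simp: inward_normal_def)
  have "(e \<bullet> e) * (n \<bullet> x) * (1 - m \<bullet> n) \<le> (e \<bullet> e) * (m \<bullet> x) - (e \<bullet> e) * (m \<bullet> n) * (x \<bullet> n)"
    using assms(4) e(3) by (simp add: algebra_simps inner_commute)
  also have "\<dots> = (m \<bullet> e) * (x \<bullet> e)"
    using inner_orthogonal_decomposition[OF e(1,2), of m x] by simp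
  also have "\<dots> < 0" using D e by (simp add: mult_pos_neg)
  finally have neg: "n \<bullet> x < 0"
    using e(3) le by (auto simp: mult_less_0_iff not_less zero_less_mult_iff)
  have "0 < (k \<bullet> e) * (x \<bullet> e)" using D e by (simp add: mult_neg_neg)
  also have "\<dots> = (e \<bullet> e) * (k \<bullet> x) - (e \<bullet> e) * (k \<bullet> n) * (x \<bullet> n)"
    using inner_orthogonal_decomposition[OF e(1,2), of k x] by simp
  also have "\<dots> \<le> (e \<bullet> e) * (n \<bullet> x) * (1 - k \<bullet> n)"
    using assms(5) e(3) by (simp add: algebra_simps inner_commute)
  also have "\<dots> \<le> 0"
    using e(3) le neg by (simp add: mult_nonneg_nonpos mult_nonpos_nonneg)
  finally show False by simp
qed

text \<open>This is the coefficient of \<open>s1 / r1\<close> in the linearised tangency condition.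
  Along \<open>e\<close> the vectors \<open>P2 - P1\<close> and \<open>P1 - A\<close> contribute a
  nonnegative amount, and along \<open>n\<close> exactly \<open>(r2 - r1) * r1\<close>, so the total
  is at least \<open>2 * r1 * r2\<close>.\<close>

lemma corner_circles_coefficient_pos:
  assumes n: "inward_normal A B C n" and m: "inward_normal A C B m" and k: "inward_normal B C A k"
    and c1: "corner_circle A B C (P1, r1)" and c2: "corner_circle B A C (P2, r2)"
  shows "0 < (P2 - P1) \<bullet> (P1 - A) + (r1 + r2) * r1"
proof -
  have n': "inward_normal B A C n" and m': "inward_normal C A B m" and k': "inward_normal C B A k"
    using n m k inward_normal_commute by blast+
  have r: "0 < r1" "0 < r2" using c1 c2 by (auto simp: corner_circle_def)
  define e where "e = B - A"
  have e: "norm n = 1" "n \<bullet> e = 0" "e \<bullet> e > 0"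
    using n by (auto simp: inward_normal_def e_def)
  have nB: "n \<bullet> B = n \<bullet> A" and kC: "k \<bullet> C = k \<bullet> B" and mC: "m \<bullet> C = m \<bullet> A"
    using n m k by (auto simp: inward_normal_def inner_diff_right)
  have a: "n \<bullet> (P1 - A) = r1" "m \<bullet> (P1 - A) = r1" "r1 \<le> k \<bullet> (P1 - B)" "0 \<le> (P1 - A) \<bullet> e"
    "n \<bullet> (P2 - B) = r2" "k \<bullet> (P2 - B) = r2" "r2 \<le> m \<bullet> (P2 - A)"
    using corner_circle_contact[OF c1 n] corner_circle_contact[OF c1[THEN corner_circle_commute[THEN iffD1]] m]
      corner_circle_clearance[OF c1 k] corner_circle_contact[OF c2 n']
      corner_circle_contact[OF c2[THEN corner_circle_commute[THEN iffD1]] k]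
      corner_circle_clearance[OF c2 m] by (auto simp: e_def)
  define x where "x = P2 - P1"
  have nx: "n \<bullet> x = r2 - r1"
    using a nB by (simp add: x_def inner_diff_right)
  \<comment> \<open>The first circle touches \<open>AC\<close> and the second keeps its radius clear
    of it, so \<open>m \<bullet> x\<close> is at least \<open>r2 - r1 = n \<bullet> x\<close>; the
    side \<open>BC\<close> gives the other inequality with the roles exchanged.\<close>
  have "0 \<le> x \<bullet> e"
    unfolding e_def using a nB kC mC nx
    by (intro nonneg_along_side[OF n m k]) (simp_all add: x_def inner_diff_right)
  then have "0 \<le> (x \<bullet> e) * ((P1 - A) \<bullet> e)" using a by simp
  moreover have "(e \<bullet> e) * (x \<bullet> (P1 - A)) = (x \<bullet> e) * ((P1 - A) \<bullet> e) + (e \<bullet> e) * ((r2 - r1) * r1)"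
    using inner_orthogonal_decomposition[OF e(1,2), of x "P1 - A"] a(1) nx
    by (simp add: inner_commute)
  ultimately have "(e \<bullet> e) * ((r2 - r1) * r1) \<le> (e \<bullet> e) * (x \<bullet> (P1 - A))"
    by simp
  then have "(r2 - r1) * r1 \<le> x \<bullet> (P1 - A)"
    using e(3) by simp
  moreover have "0 < r1 * r2" using r by simp
  ultimately show ?thesis by (simp add: x_def algebra_simps)
qed

text \<open>By \<open>corner_motion\<close> the velocities are \<open>(s\<^sub>1 / r\<^sub>1) (P\<^sub>1 - A)\<close> and \<open>(s\<^sub>2 / r\<^sub>2) (P\<^sub>2 - B)\<close>, so preserving the
  tangency is one linear equation in \<open>s\<^sub>1\<close> and \<open>s\<^sub>2\<close> whose two coefficients are positive.\<close>

lemma tangent_corner_circles_motion: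
  assumes n: "inward_normal A B C n" and m: "inward_normal A C B m" and k: "inward_normal B C A k"
    and c1: "corner_circle A B C (P1, r1)" and c2: "corner_circle B A C (P2, r2)"
    and d: "norm (P2 - P1) = r1 + r2"
    and p1: "n \<bullet> p1 = s1" "m \<bullet> p1 = s1" and p2: "n \<bullet> p2 = s2" "k \<bullet> p2 = s2"
    and cc: "sgn (P2 - P1) \<bullet> (p2 - p1) = s1 + s2"
  shows "sgn s2 = - sgn s1"
proof -
  have n': "inward_normal B A C n"
    using n inward_normal_commute by blast
  have r: "0 < r1" "0 < r2" using c1 c2 by (auto simp: corner_circle_def)
  \<comment> \<open>The coefficients of \<open>s1 / r1\<close> and \<open>s2 / r2\<close>;
    exchanging the two corners turns one into the other.\<close>
  define \<alpha> where "\<alpha> = (P2 - P1) \<bullet> (P1 - A) + (r1 + r2) * r1"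
  define \<beta> where "\<beta> = (P1 - P2) \<bullet> (P2 - B) + (r2 + r1) * r2"
  have pos: "0 < \<alpha>" "0 < \<beta>"
    unfolding \<alpha>_def \<beta>_def
    using corner_circles_coefficient_pos[OF n m k c1 c2] corner_circles_coefficient_pos[OF n' k m c2 c1]
    by auto
  have p: "p1 = (s1 / r1) *\<^sub>R (P1 - A)" "p2 = (s2 / r2) *\<^sub>R (P2 - B)"
    using corner_motion[OF n m c1 p1] corner_motion[OF n' k c2 p2] .
  have "(P2 - P1) \<bullet> (p2 - p1) = (r1 + r2) * (s1 + s2)"
    using cc r unfolding sgn_div_norm d inner_scaleR_left by (simp add: field_simps)
  moreover have "(P2 - P1) \<bullet> (p2 - p1) =
      (s2 / r2) * ((P2 - P1) \<bullet> (P2 - B)) - (s1 / r1) * ((P2 - P1) \<bullet> (P1 - A))"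
    by (simp only: p inner_diff_right[of _ "(s2 / r2) *\<^sub>R (P2 - B)"] inner_scaleR_right)
  moreover have "(P1 - P2) \<bullet> (P2 - B) = - ((P2 - P1) \<bullet> (P2 - B))"
    by (simp add: inner_diff_left)
  ultimately have "(s1 / r1) * \<alpha> + (s2 / r2) * \<beta> = 0"
    unfolding \<alpha>_def \<beta>_def using r by (simp add: algebra_simps)
  then have "s2 / r2 * \<beta> = - (s1 / r1 * \<alpha>)" by simp
  then have "sgn (s2 / r2 * \<beta>) = - sgn (s1 / r1 * \<alpha>)" by (simp only: sgn_minus)
  then show ?thesis using pos r by (simp add: sgn_mult sgn_divide)
qed

text \<open>Three sign reversals around an odd cycle give \<open>sgn s1 = - sgn s1\<close>. Stating
  them with \<open>sgn\<close> covers vanishing rates too; once all rates vanish,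
  \<open>corner_motion\<close> makes the velocities vanish.\<close>

lemma malfatti_infinitesimally_rigid:
  assumes n: "inward_normal A B C n" and m: "inward_normal A C B m" and k: "inward_normal B C A k"
    and c1: "corner_circle A B C (P1, r1)" and c2: "corner_circle B A C (P2, r2)"
    and c3: "corner_circle C A B (P3, r3)"
    and d: "norm (P2 - P1) = r1 + r2" "norm (P3 - P2) = r2 + r3" "norm (P3 - P1) = r1 + r3"
    and p: "n \<bullet> p1 = s1" "m \<bullet> p1 = s1" "n \<bullet> p2 = s2" "k \<bullet> p2 = s2" "k \<bullet> p3 = s3" "m \<bullet> p3 = s3"
    and cc: "sgn (P2 - P1) \<bullet> (p2 - p1) = s1 + s2" "sgn (P3 - P2) \<bullet> (p3 - p2) = s2 + s3"
      "sgn (P3 - P1) \<bullet> (p3 - p1) = s1 + s3"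
  shows "p1 = 0 \<and> s1 = 0 \<and> p2 = 0 \<and> s2 = 0 \<and> p3 = 0 \<and> s3 = 0"
proof -
  have n': "inward_normal B A C n" and m': "inward_normal C A B m" and k': "inward_normal C B A k"
    using n m k inward_normal_commute by blast+
  have c1': "corner_circle A C B (P1, r1)" and c2': "corner_circle B C A (P2, r2)"
    and c3': "corner_circle C B A (P3, r3)"
    using c1 c2 c3 corner_circle_commute by blast+
  have "sgn s2 = - sgn s1"
    by (rule tangent_corner_circles_motion[OF n m k c1 c2 d(1) p(1-4) cc(1)])
  \<comment> \<open>The same lemma for the sides \<open>BC\<close> and \<open>AC\<close>, with the
    vertices relabelled as \<open>B, C, A\<close> and then as \<open>A, C, B\<close>.\<close>
  moreover have "sgn s3 = - sgn s2"
    by (rule tangent_corner_circles_motion[OF k n' m' c2' c3' d(2) p(4,3,5,6) cc(2)])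
  moreover have "sgn s3 = - sgn s1"
    by (rule tangent_corner_circles_motion[OF m n k' c1' c3 d(3) p(2,1,6,5) cc(3)])
  ultimately have s: "s1 = 0" "s2 = 0" "s3 = 0"
    by (auto simp: sgn_if split: if_splits)
  then show ?thesis
    using corner_motion[OF n m c1 p(1,2)] corner_motion[OF n' k c2 p(3,4)]
      corner_motion[OF m' k' c3 p(6,5)] by simp
qed

subsection \<open>The derivative of the update map\<close>

lemma infdist_closest_point_line:
  assumes n: "inward_normal A B C n"
  shows "closest_point (line_through A B) P = P - (n \<bullet> (P - A)) *\<^sub>R n"
    and "infdist P (line_through A B) = \<bar>n \<bullet> (P - A)\<bar>"
proof -
  let ?L = "line_through A B" and ?F = "P - (n \<bullet> (P - A)) *\<^sub>R n"
  have nn: "norm n = 1" using n by (simp add: inward_normal_def)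
  have F: "?F \<in> ?L"
    using nn by (simp add: line_through_eq_hyperplane[OF n] inner_diff_right norm_eq_1)
  have dF: "dist P ?F = \<bar>n \<bullet> (P - A)\<bar>"
    using nn by (simp add: dist_norm)
  have cl: "closed ?L" "convex ?L"
    by (auto simp: line_through_def affine_imp_convex)
  have "dist P ?F \<le> dist P z" if "z \<in> ?L" for z
  proof -
    have "n \<bullet> (P - A) = n \<bullet> (P - z)"
      using that by (simp add: line_through_eq_hyperplane[OF n] inner_diff_right)
    then show ?thesis
      using Cauchy_Schwarz_ineq2[of n "P - z"] nn dF by (simp add: dist_norm)
  qed
  then show cp: "closest_point ?L P = ?F"
    using closest_point_unique[OF cl(2,1) F] by metis
  show "infdist P ?L = \<bar>n \<bullet> (P - A)\<bar>"
    using setdist_closest_point[OF cl(1), of P] F dF cp by (metis empty_iff infdist_eq_setdist)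
qed

text \<open>On the inner side the module is affine in the circle: \<open>(n, -1)\<close> is minus
  the gradient of the contact error \<open>r - n \<bullet> (P - A)\<close>.\<close>

lemma lc_correction_inside:
  assumes n: "inward_normal A B C n" and "0 < n \<bullet> (P - A)"
  shows "lc_correction q (line_through A B) (P, r) = ((1 - q) / 2 * (r - n \<bullet> (P - A))) *\<^sub>R (n, -1)"
proof -
  have "sgn n = n" using n by (simp add: inward_normal_def sgn_div_norm)
  then show ?thesis
    using assms by (simp add: lc_correction_def infdist_closest_point_line[OF n] Let_def sgn_scaleR)
qed

text \<open>The linear map \<open>f\<close> selects a circle from the state, so one statement serves
  all six modules. The affine formula is valid on an open set around \<open>X\<close>, which is
  enough for the derivative.\<close>

lemma has_derivative_lc_correction:
  assumes n: "inward_normal A B C n" and "bounded_linear f"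
    and "0 < n \<bullet> (fst (f X) - A)"
  shows "((\<lambda>Y. lc_correction q (line_through A B) (f Y)) has_derivative
    (\<lambda>h. ((1 - q) / 2 * (snd (f h) - n \<bullet> fst (f h))) *\<^sub>R (n, -1))) (at X)"
proof (rule has_derivative_transform_within_open)
  have [derivative_intros]: "(f has_derivative f) (at X)"
    using assms(2) by (rule bounded_linear_imp_has_derivative)
  show "((\<lambda>Y. ((1 - q) / 2 * (snd (f Y) - n \<bullet> (fst (f Y) - A))) *\<^sub>R (n, -1::real)) has_derivative
    (\<lambda>h. ((1 - q) / 2 * (snd (f h) - n \<bullet> fst (f h))) *\<^sub>R (n, -1))) (at X)"
    by (auto intro!: derivative_eq_intros)
  have "continuous_on UNIV f"
    using assms(2) by (rule linear_continuous_on)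
  then show "open {Y. 0 < n \<bullet> (fst (f Y) - A)}"
    by (intro open_Collect_less continuous_intros)
  fix Y assume "Y \<in> {Y. 0 < n \<bullet> (fst (f Y) - A)}"
  then show "((1 - q) / 2 * (snd (f Y) - n \<bullet> (fst (f Y) - A))) *\<^sub>R (n, -1) =
      lc_correction q (line_through A B) (f Y)"
    using lc_correction_inside[OF n, of "fst (f Y)" q "snd (f Y)"] by simp
qed (use assms in simp)

text \<open>The correction is a product of the scaled contact error \<open>e\<close> and the
  direction \<open>w\<close>. Since \<open>e X = 0\<close>, the product rule keeps only the
  derivative of \<open>e\<close> times \<open>w X\<close>.\<close>

lemma has_derivative_cc_correction:
  fixes q :: real
  assumes f: "bounded_linear f" and g: "bounded_linear g"
    and "f X = (P, r)" "g X = (P', r')" and d: "norm (P' - P) = r + r'" and "P \<noteq> P'"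
  defines "u \<equiv> sgn (P' - P)"
  shows "((\<lambda>Y. cc_correction q (f Y) (g Y)) has_derivative
    (\<lambda>h. ((1 - q) / 4 * (u \<bullet> (fst (g h) - fst (f h)) - snd (f h) - snd (g h))) *\<^sub>R
      ((u, 1), (- u, 1)))) (at X)"
proof -
  define D where "D = (\<lambda>h. (1 - q) / 4 * (u \<bullet> (fst (g h) - fst (f h)) - snd (f h) - snd (g h)))"
  have fg [derivative_intros]: "(f has_derivative f) (at X)" "(g has_derivative g) (at X)"
    using f g by (auto intro: bounded_linear_imp_has_derivative)
  define y where "y = (\<lambda>Y. fst (g Y) - fst (f Y))"
  have y: "(y has_derivative y) (at X)"
    unfolding y_def by (auto intro!: derivative_eq_intros)
  have yX: "y X = P' - P" "y X \<noteq> 0" using assms by (auto simp: y_def)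
  have ny [derivative_intros]: "((\<lambda>Y. norm (y Y)) has_derivative (\<lambda>h. y h \<bullet> u)) (at X)"
    using has_derivative_compose[OF y has_derivative_norm[OF yX(2)]] yX by (simp add: u_def)
  define e where "e = (\<lambda>Y. (1 - q) / 4 * (norm (y Y) - snd (f Y) - snd (g Y)))"
  have e: "(e has_derivative D) (at X)"
    unfolding e_def D_def by (rule derivative_eq_intros refl ny)+ (simp add: y_def inner_commute)
  have eX: "e X = 0" using assms yX by (simp add: e_def)
  define w where "w = (\<lambda>Y. ((y Y /\<^sub>R norm (y Y), 1::real), (- (y Y /\<^sub>R norm (y Y)), 1::real)))"
  have "(\<lambda>Y. y Y /\<^sub>R norm (y Y)) differentiable (at X)"
    using y ny yX by (intro differentiable_scaleR differentiable_inverse) (auto simp: differentiable_def)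
  \<comment> \<open>Only the existence of \<open>v\<close> matters, because the product rule
    multiplies it by \<open>e X = 0\<close>.\<close>
  then obtain v where [derivative_intros]: "((\<lambda>Y. y Y /\<^sub>R norm (y Y)) has_derivative v) (at X)"
    by (auto simp: differentiable_def)
  have "(w has_derivative (\<lambda>h. ((v h, 0), (- v h, 0)))) (at X)"
    unfolding w_def by (intro derivative_intros)
  from has_derivative_scaleR[OF e this] have "((\<lambda>Y. e Y *\<^sub>R w Y) has_derivative (\<lambda>h. D h *\<^sub>R w X)) (at X)"
    by (simp add: eX flip: zero_prod_def)
  moreover have "cc_correction q (f Y) (g Y) = e Y *\<^sub>R w Y" for Y
    by (simp add: cc_correction_def e_def w_def y_def Let_def split: prod.splits)
  moreover have "w X = ((u, 1), (- u, 1))"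
    using yX by (simp add: w_def u_def sgn_div_norm)
  ultimately show ?thesis by (simp add: D_def)
qed

lemma open_update_domain: "open (update_domain A B C)"
proof -
  have op: "open {X. f X \<notin> line_through D E}" if "continuous_on UNIV f"
    for f :: "state \<Rightarrow> point" and D E
    using that open_vimage[of "- line_through D E" f]
    by (simp add: line_through_def open_Compl vimage_def)
  have "update_domain A B C = {X. fst (fst X) \<notin> line_through A B \<and> fst (fst X) \<notin> line_through A C \<and>
     fst (fst (snd X)) \<notin> line_through A B \<and> fst (fst (snd X)) \<notin> line_through B C \<and>
     fst (snd (snd X)) \<notin> line_through B C \<and> fst (snd (snd X)) \<notin> line_through C A \<and>
     fst (fst X) \<noteq> fst (fst (snd X)) \<and> fst (fst (snd X)) \<noteq> fst (snd (snd X)) \<and>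
     fst (fst X) \<noteq> fst (snd (snd X))}"
    unfolding update_domain_def by force
  also have "open \<dots>"
    by (intro open_Collect_conj op open_Collect_neq continuous_intros)
  finally show ?thesis .
qed

text \<open>The lower bound on \<open>q\<close> is the trace condition
  \<open>9 * (1 - q) < 2\<close>, and \<open>q < 1\<close> makes the weights positive.\<close>

lemma malfatti_update_map:
  fixes A B C :: point and X :: state
  assumes nc: "\<not> collinear {A, B, C}" and mal: "is_malfatti A B C X"
    and q: "7 / 9 < q" "q < 1"
  defines "D \<equiv> update_domain A B C" and "T \<equiv> update_map q A B C"
  shows "X \<in> D" "T X = X"
    and "\<exists>L. (T has_derivative L) (at X) \<and> (\<forall>v. v \<noteq> 0 \<longrightarrow> norm (L v) < norm v)"
proof -
  obtain P1 r1 P2 r2 P3 r3 where X: "X = ((P1, r1), (P2, r2), (P3, r3))"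
    by (metis prod.exhaust)
  obtain n where n: "inward_normal A B C n"
    using exists_inward_normal nc by blast
  obtain m where m: "inward_normal A C B m"
    using exists_inward_normal[of A C B] nc by (metis insert_commute)
  obtain k where k: "inward_normal B C A k"
    using exists_inward_normal[of B C A] nc by (metis insert_commute)
  have c1: "corner_circle A B C (P1, r1)" and c2: "corner_circle B A C (P2, r2)"
    and c3: "corner_circle C A B (P3, r3)"
    using mal tangent_to_side_commute
    by (auto simp: corner_circle_def is_malfatti_def X insert_commute)
  have n': "inward_normal B A C n" and m': "inward_normal C A B m" and k': "inward_normal C B A k"
    using n m k inward_normal_commute by blast+
  have c1': "corner_circle A C B (P1, r1)" and c2': "corner_circle B C A (P2, r2)"
    and c3': "corner_circle C B A (P3, r3)"
    using c1 c2 c3 corner_circle_commute by blast+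
  have r: "0 < r1" "0 < r2" "0 < r3"
    using c1 c2 c3 by (auto simp: corner_circle_def)
  have d: "norm (P2 - P1) = r1 + r2" "norm (P3 - P2) = r2 + r3" "norm (P3 - P1) = r1 + r3"
    using mal r by (auto simp: is_malfatti_def X intro!: externally_tangent_dist)
  have ne: "P1 \<noteq> P2" "P2 \<noteq> P3" "P1 \<noteq> P3" using d r by auto
  have ends: "n \<bullet> (B - A) = 0" "k \<bullet> (C - B) = 0" "m \<bullet> (C - A) = 0"
    using n m k by (auto simp: inward_normal_def)
  have h: "n \<bullet> (P1 - A) = r1" "m \<bullet> (P1 - A) = r1" "n \<bullet> (P2 - A) = r2" "k \<bullet> (P2 - B) = r2"
    "k \<bullet> (P3 - B) = r3" "m \<bullet> (P3 - A) = r3"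
    using corner_circle_contact(1)[OF c1 n] corner_circle_contact(1)[OF c1' m]
      corner_circle_contact(1)[OF c2 n'] corner_circle_contact(1)[OF c2' k]
      corner_circle_contact(1)[OF c3' k'] corner_circle_contact(1)[OF c3 m'] ends
    by (auto simp: inner_diff_right)
  have hm: "m \<bullet> (P3 - C) = r3"
    using corner_circle_contact(1)[OF c3 m'] .
  show "X \<in> D"
    using h hm r ne unfolding D_def update_domain_def X
    by (auto simp: line_through_eq_hyperplane[OF n] line_through_eq_hyperplane[OF m]
        line_through_eq_hyperplane[OF m'] line_through_eq_hyperplane[OF k])
  show "T X = X"
    unfolding T_def update_map_def X
    using r h hm d lc_correction_inside[OF n, of P1 q r1] lc_correction_inside[OF n, of P2 q r2]
      lc_correction_inside[OF m, of P1 q r1] lc_correction_inside[OF m', of P3 q r3]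
      lc_correction_inside[OF k, of P2 q r2] lc_correction_inside[OF k, of P3 q r3]
    by (simp add: cc_correction_def Let_def zero_prod_def)
  define c where "c = 1 - q"
  define u where "u = sgn (P2 - P1)"
  define v where "v = sgn (P3 - P2)"
  define w where "w = sgn (P3 - P1)"
  \<comment> \<open>The gradients \<open>g\<^sub>i\<close> of the nine contact errors, paired with the factors \<open>(1 - q) / (g\<^sub>i \<bullet> g\<^sub>i)\<close>.\<close>
  define ws :: "(real \<times> state) list" where
    "ws = [(c/2, ((-n, 1), 0, 0)), (c/2, ((-m, 1), 0, 0)),
           (c/2, (0, (-n, 1), 0)), (c/2, (0, (-k, 1), 0)),
           (c/2, (0, 0, (-k, 1))), (c/2, (0, 0, (-m, 1))),
           (c/4, ((-u, -1), (u, -1), 0)), (c/4, (0, (-v, -1), (v, -1))),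
           (c/4, ((-w, -1), 0, (w, -1)))]"
  define L where "L = (\<lambda>h. h - (\<Sum>i<9. (fst (ws ! i) * (snd (ws ! i) \<bullet> h)) *\<^sub>R snd (ws ! i)))"
  have sum9: "(\<Sum>i<9. f i) = f 0 + f 1 + f 2 + f 3 + f 4 + f 5 + f 6 + f 7 + f 8"
    for f :: "nat \<Rightarrow> 'b::comm_monoid_add"
    by (simp add: eval_nat_numeral)
  have bl: "bounded_linear (fst :: state \<Rightarrow> _)" "bounded_linear (\<lambda>X::state. fst (snd X))"
    "bounded_linear (\<lambda>X::state. snd (snd X))"
    by (auto intro!: bounded_linear_intros)
  have norms: "n \<bullet> n = 1" "m \<bullet> m = 1" "k \<bullet> k = 1" "u \<bullet> u = 1" "v \<bullet> v = 1" "w \<bullet> w = 1"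
    using n m k ne by (auto simp: inward_normal_def norm_eq_1[symmetric] u_def v_def w_def norm_sgn)
  have "(T has_derivative L) (at X)"
  proof -
    note lc = has_derivative_lc_correction[where q = q and X = X]
    note cc = has_derivative_cc_correction[where q = q and X = X]
    have lcs: "0 < n \<bullet> (fst (fst X) - A)" "0 < m \<bullet> (fst (fst X) - A)"
      "0 < n \<bullet> (fst (fst (snd X)) - A)" "0 < k \<bullet> (fst (fst (snd X)) - B)"
      "0 < k \<bullet> (fst (snd (snd X)) - B)" "0 < m \<bullet> (fst (snd (snd X)) - C)"
      using h hm r by (simp_all add: X)
    have coord: "fst X = (P1, r1)" "fst (snd X) = (P2, r2)" "snd (snd X) = (P3, r3)"
      by (simp_all add: X)
    note cc12 = cc[OF bl(1,2) coord(1,2) d(1) ne(1)]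
      and cc23 = cc[OF bl(2,3) coord(2,3) d(2) ne(2)]
      and cc13 = cc[OF bl(1,3) coord(1,3) d(3) ne(3)]
    note add = has_derivative_add and id = bl[THEN bounded_linear_imp_has_derivative]
    \<comment> \<open>One derivative per circle, nested like the sums in \<open>update_map\<close>.
      The third uses \<open>m'\<close> instead of \<open>m\<close> because its module refers to
      \<open>line_through C A\<close>.\<close>
    note D1 = add[OF add[OF add[OF add[OF id(1) lc[OF n bl(1) lcs(1)]] lc[OF m bl(1) lcs(2)]]
            cc12[THEN has_derivative_fst]] cc13[THEN has_derivative_fst]]
      and D2 = add[OF add[OF add[OF add[OF id(2) lc[OF n bl(2) lcs(3)]] lc[OF k bl(2) lcs(4)]]
            cc12[THEN has_derivative_snd]] cc23[THEN has_derivative_fst]]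
      and D3 = add[OF add[OF add[OF add[OF id(3) lc[OF k bl(3) lcs(5)]] lc[OF m' bl(3) lcs(6)]]
            cc23[THEN has_derivative_snd]] cc13[THEN has_derivative_snd]]
    show ?thesis
      unfolding T_def update_map_def[abs_def] case_prod_beta
    proof (rule has_derivative_eq_rhs[OF has_derivative_Pair[OF D1 has_derivative_Pair[OF D2 D3]]],
        rule ext, goal_cases)
      case (1 x)
      obtain p1 s1 p2 s2 p3 s3 where x: "x = ((p1, s1), (p2, s2), (p3, s3))"
        by (metis prod.exhaust)
      show ?case
        unfolding L_def sum9 ws_def u_def[symmetric] v_def[symmetric] w_def[symmetric] c_def[symmetric]
        by (simp add: x inner_diff_right algebra_simps add_divide_distrib diff_divide_distrib)
    qed
  qed
  moreover have "norm (L x) < norm x" if "x \<noteq> 0" for x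
    unfolding L_def
  proof (rule norm_minus_weighted_projections_less)
    show "finite {..<9::nat}" by simp
    show "0 < fst (ws ! i)" if "i \<in> {..<9}" for i
    proof -
      have "\<forall>x\<in>set ws. 0 < fst x" using q by (simp add: ws_def c_def)
      moreover have "length ws = 9" by (simp add: ws_def)
      ultimately show ?thesis using that by simp
    qed
    \<comment> \<open>The squared norms of the gradients are 2 for lines and 4 for pairs of circles,
      so every module contributes \<open>c\<close> and the sum is \<open>9 * c\<close>.\<close>
    show "(\<Sum>i<9. fst (ws ! i) * (snd (ws ! i) \<bullet> snd (ws ! i))) < 2"
      using q by (simp add: sum9 ws_def norms c_def field_simps)
    show "\<exists>i\<in>{..<9}. snd (ws ! i) \<bullet> x \<noteq> 0"
    proof (rule ccontr)
      assume "\<not> ?thesis"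
      then have z: "snd (ws ! i) \<bullet> x = 0" if "i < 9" for i using that by simp
      obtain p1 s1 p2 s2 p3 s3 where x: "x = ((p1, s1), (p2, s2), (p3, s3))"
        by (metis prod.exhaust)
      \<comment> \<open>A vector orthogonal to all nine gradients preserves every contact to first
        order: the first six equations are the line contacts, the last three the circle
        contacts.\<close>
      have "p1 = 0 \<and> s1 = 0 \<and> p2 = 0 \<and> s2 = 0 \<and> p3 = 0 \<and> s3 = 0"
        by (rule malfatti_infinitesimally_rigid[OF n m k c1 c2 c3 d])
          (use z[of 0] z[of 1] z[of 2] z[of 3] z[of 4] z[of 5] z[of 6] z[of 7] z[of 8]
            in \<open>simp_all add: ws_def x u_def v_def w_def inner_diff_right\<close>)
      with \<open>x \<noteq> 0\<close> show False by (simp add: x zero_prod_def)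
    qed
  qed
  ultimately show "\<exists>L. (T has_derivative L) (at X) \<and> (\<forall>v. v \<noteq> 0 \<longrightarrow> norm (L v) < norm v)"
    by blast
qed

theorem theorem1:
  fixes A B C :: point and X_Mal :: state
  assumes "\<not> collinear {A, B, C}"
    and "is_malfatti A B C X_Mal"
  shows "(\<exists>U. open U \<and> X_Mal \<in> U \<and>
            (\<forall>X0\<in>U. iterates_defined (update_domain A B C) (update_map 0.9 A B C) X0 \<and>
               converges_geometrically (\<lambda>n. (update_map 0.9 A B C ^^ n) X0) X_Mal)) \<and>
         fixed_point_on (update_domain A B C) (update_map 0.9 A B C) X_Mal \<and>
         locally_asymptotically_stable (update_domain A B C) (update_map 0.9 A B C) X_Mal"
proof -
  obtain L where L: "(update_map 0.9 A B C has_derivative L) (at X_Mal)"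
      "\<And>v. v \<noteq> 0 \<Longrightarrow> norm (L v) < norm v"
    using malfatti_update_map(3)[OF assms, of "0.9"] by auto
  have fp: "X_Mal \<in> update_domain A B C" "update_map 0.9 A B C X_Mal = X_Mal"
    using malfatti_update_map(1,2)[OF assms, of "0.9"] by auto
  show ?thesis
    using locally_asymptotically_stable_derivative[OF open_update_domain fp L] fp
    by (simp add: fixed_point_on_def)
qed

end
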